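(* Let $p$ be a prime and $G=S^1\times C_p$. For every integer $n\ge 1$ there exist an integer $m\ge n$ and a continuous $G$-equivariant map $f_n:S(V_n)\to S(W_m)$.
   Context: $S^1=\{t\in\mathbb{C}:|t|=1\}$, $C_p$ is cyclic of prime order $p$ with generator $a$, and elements of $G=S^1\times C_p$ are written $ta^i$. Let $\xi_p=\exp(2\pi\sqrt{-1}/p)$. For $k\in\mathbb{Z}$ and $l\in\mathbb{Z}/p$, $V_{k,l}$ is the one-dimensional complex (unitary) $G$-representation with underlying space $\mathbb{C}$ and action $t\cdot z=t^kz$, $a\cdot z=\xi_p^l z$. For $n,m\ge1$ set $V_n=V_{1,1}\oplus V_{p,1}\oplus\cdots\oplus V_{p^{n-1},1}$ (real dimension $2n$) and $W_m=V_{p^m,0}\oplus V_{0,1}$ (real dimension $4$). $S(V)$ denotes the unit sphere of a representation $V$. *)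

theory Defs
  imports "HOL-Analysis.Analysis"
begin

definition xi :: "nat \<Rightarrow> complex" where
  "xi p = exp (2 * of_real pi * \<i> / of_nat p)"

text \<open>Unit sphere S(V_n): vectors in C^n, modelled as functions nat => complex
  vanishing at all indices >= n (coordinate j corresponds to V_{p^j,1}).\<close>
definition sphereV :: "nat \<Rightarrow> (nat \<Rightarrow> complex) set" where
  "sphereV n = {z. (\<forall>j\<ge>n. z j = 0) \<and> (\<Sum>j<n. (cmod (z j))\<^sup>2) = 1}"

definition actV :: "nat \<Rightarrow> nat \<Rightarrow> complex \<Rightarrow> nat \<Rightarrow> (nat \<Rightarrow> complex) \<Rightarrow> (nat \<Rightarrow> complex)" where
  "actV p n t i z = (\<lambda>j. if j < n then t ^ (p ^ j) * xi p ^ i * z j else 0)"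

text \<open>Unit sphere S(W_m) in C^2 = V_{p^m,0} + V_{0,1}.\<close>
definition sphereW :: "(complex \<times> complex) set" where
  "sphereW = {w. (cmod (fst w))\<^sup>2 + (cmod (snd w))\<^sup>2 = 1}"

definition actW :: "nat \<Rightarrow> nat \<Rightarrow> complex \<Rightarrow> nat \<Rightarrow> complex \<times> complex \<Rightarrow> complex \<times> complex" where
  "actW p m t i w = (t ^ (p ^ m) * fst w, xi p ^ i * snd w)"

end

theory Submission
  imports Defs
begin

text \<open>
  The map is built together with a \<open>G\<close>-homotopy \<open>\<phi> \<circ> f \<simeq> f\<close>, where \<open>\<phi>(X, Y) = (X, Y\<^sup>p\<^sup>+\<^sup>1)\<close>
  (moduli kept), over larger and larger open \<open>G\<close>-subsets of the sphere. The step is an eigenvalue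
  argument: \<open>\<kappa>(X, Y) = (X\<^sup>p, Y)\<close> raises \<open>m\<close> by one and has degree \<open>p\<close>, \<open>\<phi>\<close> has degree \<open>p + 1\<close>, so in
  the group of unit quaternions \<open>\<kappa>\<close> is (non-equivariantly) homotopic to \<open>x \<mapsto> \<phi>(x) x\<^sup>-\<^sup>1\<close>. Hence
  \<open>\<phi> \<circ> f \<simeq> f\<close> makes \<open>\<kappa> \<circ> f\<close> null-homotopic, and one further composition with \<open>\<kappa>\<close> also kills the
  obstruction to extending the homotopy. A map can therefore be extended over an open \<open>G\<close>-set that
  carries a \<open>G\<close>-map to an orbit whose isotropy group acts trivially on \<open>W\<^sub>m\<close>: there the equivariance
  can be divided out. Near the coordinate circles a map is given by powers of the coordinate, and off
  them the phase of \<open>z\<^sub>j\<close> times a power of the conjugate of \<open>z\<^sub>i\<close>, on which \<open>S\<^sup>1\<close> acts trivially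
  and \<open>a\<close> by \<open>\<xi>\<^sub>p\<close>, provides finitely many such sets.
\<close>

section \<open>Unit quaternions and two self-maps of the sphere\<close>

text \<open>The \<open>d\<close>-th power map of the circle, extended radially so that it acts on
  one coordinate without leaving the sphere.\<close>

definition wind :: "nat \<Rightarrow> complex \<Rightarrow> complex" where
  "wind d X = of_real (cmod X) * sgn X ^ d"

definition kap :: "nat \<Rightarrow> complex \<times> complex \<Rightarrow> complex \<times> complex" where
  "kap d x = (wind d (fst x), snd x)"

text \<open>With exponent \<open>d + 1\<close> the map commutes with rotating the second coordinate
  by a \<open>d\<close>-th root of unity.\<close>

definition phi :: "nat \<Rightarrow> complex \<times> complex \<Rightarrow> complex \<times> complex" where
  "phi d x = (fst x, wind (Suc d) (snd x))"

text \<open>The pair (X, Y) stands for the quaternion X + j Y.\<close>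

definition qmul :: "complex \<times> complex \<Rightarrow> complex \<times> complex \<Rightarrow> complex \<times> complex" (infixl "\<odot>" 70) where
  "x \<odot> y = (fst x * fst y - cnj (snd x) * snd y, snd x * fst y + cnj (fst x) * snd y)"

definition qinv :: "complex \<times> complex \<Rightarrow> complex \<times> complex" where
  "qinv x = (cnj (fst x), - snd x)"

definition qone :: "complex \<times> complex" where
  "qone = (1, 0)"

section \<open>Arithmetic of unit quaternions\<close>

lemma sphereW_iff_norm: "x \<in> sphereW \<longleftrightarrow> norm x = 1"
  by (simp add: sphereW_def norm_prod_def real_sqrt_eq_1_iff)

text \<open>Euler's four-square identity.\<close>

lemma norm_qmul: "norm (x \<odot> y) = norm x * norm y"
proof -
  have "(norm (x \<odot> y))\<^sup>2 = (norm x * norm y)\<^sup>2"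
    by (simp add: qmul_def norm_prod_def power_mult_distrib cmod_power2) algebra
  then show ?thesis by simp
qed

lemma qmul_assoc: "(x \<odot> y) \<odot> z = x \<odot> (y \<odot> z)"
  by (simp add: qmul_def algebra_simps)

lemma qmul_in [simp]: "x \<in> sphereW \<Longrightarrow> y \<in> sphereW \<Longrightarrow> x \<odot> y \<in> sphereW"
  by (simp add: sphereW_iff_norm norm_qmul)

lemma qinv_in [simp]: "x \<in> sphereW \<Longrightarrow> qinv x \<in> sphereW"
  by (simp add: sphereW_def qinv_def)

lemma qone_in [simp]: "qone \<in> sphereW"
  by (simp add: sphereW_def qone_def)

lemma qmul_qone [simp]: "x \<odot> qone = x" "qone \<odot> x = x"
  by (simp_all add: qmul_def qone_def)

lemma qinv_qone [simp]: "qinv qone = qone"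
  by (simp add: qinv_def qone_def)

lemma qmul_qinv [simp]:
  assumes "x \<in> sphereW"
  shows "x \<odot> qinv x = qone" "qinv x \<odot> x = qone"
proof -
  have "complex_of_real ((cmod (fst x))\<^sup>2 + (cmod (snd x))\<^sup>2) = 1"
    using assms by (simp add: sphereW_def)
  then have "fst x * cnj (fst x) + snd x * cnj (snd x) = 1"
    by (simp add: complex_norm_square del: of_real_power)
  then show "x \<odot> qinv x = qone" "qinv x \<odot> x = qone"
    by (simp_all add: qmul_def qinv_def qone_def algebra_simps)
qed

lemma qmul_cancel [simp]:
  assumes "x \<in> sphereW"
  shows "x \<odot> (qinv x \<odot> z) = z" "qinv x \<odot> (x \<odot> z) = z"
  using assms by (simp_all flip: qmul_assoc)

section \<open>Winding maps\<close>

lemma norm_wind [simp]: "cmod (wind d X) = cmod X"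
  by (cases "X = 0") (simp_all add: wind_def norm_mult norm_power norm_sgn)

lemma wind_eq_0_iff [simp]: "wind d X = 0 \<longleftrightarrow> X = 0"
  using norm_wind[of d X] by (metis norm_eq_zero)

lemma wind_mult: "cmod a = 1 \<Longrightarrow> wind d (a * X) = a ^ d * wind d X"
  by (simp add: wind_def norm_mult sgn_mult power_mult_distrib sgn_div_norm)

lemma wind_1 [simp]: "wind d 1 = 1"
  by (simp add: wind_def)

lemma continuous_on_wind [continuous_intros]:
  assumes "continuous_on S f"
  shows "continuous_on S (\<lambda>x. wind d (f x))"
proof -
  have "isCont (wind d) X" for X
  proof (cases "X = 0")
    case True
    have "((\<lambda>X::complex. cmod (wind d X)) \<longlongrightarrow> 0) (at 0)"
      by (simp add: tendsto_norm_zero)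
    then have "(wind d \<longlongrightarrow> 0) (at 0)"
      by (rule tendsto_norm_zero_cancel)
    then show ?thesis
      using True by (simp add: isCont_def wind_def)
  next
    case False
    then show ?thesis
      unfolding wind_def by (intro continuous_intros) auto
  qed
  then have "continuous_on UNIV (wind d)"
    by (simp add: continuous_at_imp_continuous_on)
  then show ?thesis
    using assms by (rule continuous_on_compose2) auto
qed

lemma continuous_on_kap [continuous_intros]:
  "continuous_on S f \<Longrightarrow> continuous_on S (\<lambda>x. kap d (f x))"
  unfolding kap_def by (intro continuous_intros)

lemma continuous_on_phi [continuous_intros]:
  "continuous_on S f \<Longrightarrow> continuous_on S (\<lambda>x. phi d (f x))"
  unfolding phi_def by (intro continuous_intros)

lemma continuous_on_qmul [continuous_intros]:
  "continuous_on S f \<Longrightarrow> continuous_on S g \<Longrightarrow> continuous_on S (\<lambda>x. f x \<odot> g x)"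
  unfolding qmul_def by (intro continuous_intros)

lemma continuous_on_qinv [continuous_intros]:
  "continuous_on S f \<Longrightarrow> continuous_on S (\<lambda>x. qinv (f x))"
  unfolding qinv_def by (intro continuous_intros)

lemma kap_in [simp]: "x \<in> sphereW \<Longrightarrow> kap d x \<in> sphereW"
  and phi_in [simp]: "x \<in> sphereW \<Longrightarrow> phi d x \<in> sphereW"
  by (simp_all add: sphereW_def kap_def phi_def)

lemma kap_qone [simp]: "kap d qone = qone"
  and phi_qone [simp]: "phi d qone = qone"
  by (simp_all add: kap_def phi_def qone_def)

lemma kap_phi: "kap d (phi e x) = phi e (kap d x)"
  by (simp add: kap_def phi_def)

text \<open>
  If the first coordinate \<open>X wind(X) - |Y|\<^sup>2\<close> of the product vanishes, the phase of \<open>X\<close> is a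
  \<open>(d+1)\<close>-st root of unity, and the second coordinate is a positive multiple of \<open>X Y\<close>. As \<open>\<epsilon>\<close> is not
  such a root, the straight line to \<open>- \<epsilon> Y\<close> avoids zero.
\<close>
lemma kap_qmul_self_homotopic:
  "homotopic_with_canon (\<lambda>_. True) sphereW (- {0}) (\<lambda>x. kap d x \<odot> x) (kap (Suc d))"
proof -
  define \<epsilon> where "\<epsilon> = cis (pi / (real d + 1))"
  have e1: "cmod \<epsilon> = 1"
    by (simp add: \<epsilon>_def)
  have "\<epsilon> ^ Suc d = cis (real (Suc d) * (pi / (real d + 1)))"
    by (simp only: \<epsilon>_def Complex.DeMoivre)
  also have "real (Suc d) * (pi / (real d + 1)) = pi"
    by (simp add: field_simps)
  finally have e2: "\<epsilon> ^ Suc d = -1"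
    by simp
  have e3: "\<epsilon> \<noteq> 1" using e2 by auto
  define f where "f x = (fst x * wind d (fst x) - of_real ((cmod (snd x))\<^sup>2), - (snd x * \<epsilon>))" for x
  have *: "cmod (fst x * wind d (fst x)) = 1" if "x \<in> sphereW" "snd x = 0" for x
    using that by (simp add: norm_mult sphereW_def power2_eq_square)
  have "homotopic_with_canon (\<lambda>_. True) sphereW (- {0}) (\<lambda>x. kap d x \<odot> x) f"
  proof (rule homotopic_with_linear)
    fix x :: "complex \<times> complex" assume x: "x \<in> sphereW"
    obtain X Y where xy: "x = (X, Y)" by (cases x)
    have "(1 - u) *\<^sub>R (kap d x \<odot> x) + u *\<^sub>R f x \<noteq> 0" if u: "0 \<le> u" "u \<le> 1" for u
    proof
      assume 0: "(1 - u) *\<^sub>R (kap d x \<odot> x) + u *\<^sub>R f x = 0"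
      let ?P = "X * wind d X - of_real ((cmod Y)\<^sup>2)"
      have "(1 - u) *\<^sub>R ?P + u *\<^sub>R ?P = 0"
        using 0 unfolding xy f_def qmul_def kap_def
        by (simp add: zero_prod_def complex_norm_square algebra_simps del: of_real_power)
      then have P: "X * wind d X = of_real ((cmod Y)\<^sup>2)"
        by (simp flip: scaleR_add_left)
      have Q: "Y * ((1 - u) *\<^sub>R (X + cnj (wind d X)) - u *\<^sub>R \<epsilon>) = 0"
        using 0 unfolding xy f_def qmul_def kap_def
        by (simp add: zero_prod_def algebra_simps)
      have Y: "Y \<noteq> 0"
        using * [OF x] P by (auto simp: xy)
      then have X: "X \<noteq> 0" using P by auto
      define \<eta> where "\<eta> = sgn X"
      have \<eta>: "cmod \<eta> = 1" "X = of_real (cmod X) * \<eta>"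
        using X by (simp add: \<eta>_def norm_sgn, simp add: \<eta>_def sgn_eq)
      have "X * wind d X = of_real (cmod X) * \<eta> * wind d X"
        by (rule arg_cong[OF \<eta>(2)])
      then have *: "of_real ((cmod X)\<^sup>2) * \<eta> ^ Suc d = of_real ((cmod Y)\<^sup>2)"
        unfolding P by (simp add: wind_def \<eta>_def power2_eq_square)
      define c where "c = (cmod Y)\<^sup>2 / (cmod X)\<^sup>2"
      have c: "\<eta> ^ Suc d = of_real c"
        using X * by (simp add: c_def eq_divide_eq mult.commute)
      have "cmod (\<eta> ^ Suc d) = 1"
        using \<eta>(1) by (simp only: norm_power power_one)
      moreover have "0 \<le> c"
        by (simp add: c_def)
      ultimately have "c = 1"
        unfolding c by simp
      with c have \<eta>1: "\<eta> ^ Suc d = 1" by simp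
      have "\<eta> ^ d * \<eta> = 1"
        using \<eta>1 by (simp only: power_Suc2)
      moreover have "\<eta> ^ d * cnj (\<eta> ^ d) = 1"
        using complex_norm_square[of "\<eta> ^ d"] \<eta>(1) by (simp only: norm_power power_one of_real_1)
      ultimately have "cnj (\<eta> ^ d) = \<eta>"
        by (metis mult_left_cancel mult_zero_left zero_neq_one)
      then have "cnj (wind d X) = of_real (cmod X) * \<eta>"
        by (simp add: wind_def flip: \<eta>_def)
      then have "cnj (wind d X) = X"
        unfolding \<eta>(2)[symmetric] .
      moreover have "(1 - u) *\<^sub>R (X + cnj (wind d X)) - u *\<^sub>R \<epsilon> = 0"
        using Q Y by simp
      ultimately have "u *\<^sub>R \<epsilon> = of_real (2 * (1 - u)) * X"
        by (simp add: scaleR_conv_of_real algebra_simps)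
      also have "\<dots> = of_real (2 * (1 - u)) * (of_real (cmod X) * \<eta>)"
        by (rule arg_cong[OF \<eta>(2)])
      finally have E: "of_real (2 * (1 - u) * cmod X) * \<eta> = of_real u * \<epsilon>"
        by (simp add: scaleR_conv_of_real)
      then have "cmod (of_real (2 * (1 - u) * cmod X) * \<eta>) = cmod (of_real u * \<epsilon>)"
        by simp
      then have "2 * (1 - u) * cmod X = u"
        using \<eta>(1) e1 u by (simp only: norm_mult norm_of_real) (simp add: abs_mult)
      moreover from this have "u \<noteq> 0" using X by auto
      ultimately have "\<eta> = \<epsilon>" using E by simp
      then show False using \<eta>1 e2 by simp
    qed
    then show "closed_segment (kap d x \<odot> x) (f x) \<subseteq> - {0}"
      by (auto simp: closed_segment_def)
  qed (auto simp: f_def intro!: continuous_intros)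
  \<comment> \<open>The second coordinate along this segment is Y (u - (1 - u) \<epsilon>), which
    vanishes only for Y = 0 because \<epsilon> \<noteq> 1; for Y = 0 both ends coincide.\<close>
  moreover have "homotopic_with_canon (\<lambda>_. True) sphereW (- {0}) f (kap (Suc d))"
  proof (rule homotopic_with_linear)
    fix x :: "complex \<times> complex" assume x: "x \<in> sphereW"
    obtain X Y where xy: "x = (X, Y)" by (cases x)
    have "(1 - u) *\<^sub>R f x + u *\<^sub>R kap (Suc d) x \<noteq> 0" if u: "0 \<le> u" "u \<le> 1" for u
    proof
      assume 0: "(1 - u) *\<^sub>R f x + u *\<^sub>R kap (Suc d) x = 0"
      have "Y * (of_real u - of_real (1 - u) * \<epsilon>) = 0"
        using 0 unfolding xy f_def kap_def
        by (simp add: zero_prod_def scaleR_conv_of_real algebra_simps)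
      moreover have "of_real u - of_real (1 - u) * \<epsilon> \<noteq> 0"
      proof
        assume A: "of_real u - of_real (1 - u) * \<epsilon> = 0"
        then have "cmod (of_real u) = cmod (of_real (1 - u) * \<epsilon>)" by simp
        then have "u = 1 - u" using e1 u by (simp only: norm_mult norm_of_real) simp
        then have u: "u = 1 / 2" by simp
        show False using A e3 unfolding u by simp
      qed
      ultimately have Y: "Y = 0" by simp
      then have X: "cmod X = 1" using x by (simp add: xy sphereW_iff_norm norm_Pair)
      have "(1 - u) *\<^sub>R (X * wind d X) + u *\<^sub>R wind (Suc d) X = 0"
        using 0 Y unfolding xy f_def kap_def by (simp add: zero_prod_def)
      moreover have "X * wind d X = wind (Suc d) X"
        using X by (simp add: wind_def sgn_div_norm)
      ultimately have "wind (Suc d) X = 0"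
        by (simp flip: scaleR_add_left)
      then show False using norm_wind[of "Suc d" X] X by simp
    qed
    then show "closed_segment (f x) (kap (Suc d) x) \<subseteq> - {0}"
      by (auto simp: closed_segment_def)
  qed (auto simp: f_def intro!: continuous_intros)
  ultimately show ?thesis by (rule homotopic_with_trans)
qed

text \<open>A quarter turn of C^2 swaps the coordinates up to sign, so conjugating with the real
  rotation through s pi/2 moves the winding from the first coordinate to the second.\<close>

lemma kap_phi_homotopic:
  "homotopic_with_canon (\<lambda>_. True) sphereW (- {0}) (kap (Suc d)) (phi d)"
proof -
  define r where "r s x = (cos s *\<^sub>R fst x + sin s *\<^sub>R snd x, cos s *\<^sub>R snd x - sin s *\<^sub>R fst x)"
    for s :: real and x :: "complex \<times> complex"
  define h where "h = (\<lambda>(s, x). r (- (s * (pi / 2))) (kap (Suc d) (r (s * (pi / 2)) x)))"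
  have rr: "r (- s) (r s x) = x" for s x
  proof -
    have "r (- s) (r s x) = (cos s * cos s + sin s * sin s) *\<^sub>R x"
      by (simp add: r_def prod_eq_iff algebra_simps del: sin_cos_squared_add3)
    then show ?thesis by simp
  qed
  have r0: "r s 0 = 0" for s by (simp add: r_def zero_prod_def)
  have k0: "kap e x = 0 \<longleftrightarrow> x = 0" for e x
    by (auto simp: kap_def prod_eq_iff)
  have nz: "r (- s) (kap (Suc d) (r s x)) \<noteq> 0" if "x \<in> sphereW" for s x
  proof -
    have "x \<noteq> 0"
      using that by (auto simp: sphereW_iff_norm)
    then show ?thesis
      using rr r0 k0 by (metis minus_minus)
  qed
  have "h ` ({0..1} \<times> sphereW) \<subseteq> - {0}"
  proof
    fix y assume "y \<in> h ` ({0..1} \<times> sphereW)"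
    then obtain s x where "x \<in> sphereW" "y = h (s, x)" by blast
    then show "y \<in> - {0}" using nz[of x "s * (pi / 2)"] by (simp add: h_def)
  qed
  moreover have "continuous_on ({0..1} \<times> sphereW) h"
    unfolding h_def r_def case_prod_beta by (intro continuous_intros)
  moreover have "h (0, x) = kap (Suc d) x" "h (1, x) = phi d x" for x
    by (simp_all add: h_def r_def kap_def phi_def)
  ultimately show ?thesis
    unfolding homotopic_with_def by (intro exI[of _ h]) (auto simp: image_subset_iff)
qed

text \<open>A homotopy inside the sphere from \<kappa> to x |-> \<phi>(x) x^-1. Fixing 1 keeps the
  ends of \<open>obloop\<close> at 1 when \<open>C\<close> is applied to it.\<close>

locale kap_contraction =
  fixes d :: nat and C :: "real \<Rightarrow> complex \<times> complex \<Rightarrow> complex \<times> complex"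
  assumes C_cont: "continuous_on ({0..1} \<times> sphereW) (\<lambda>(u, x). C u x)"
    and C_in: "0 \<le> u \<Longrightarrow> u \<le> 1 \<Longrightarrow> x \<in> sphereW \<Longrightarrow> C u x \<in> sphereW"
    and C_0: "x \<in> sphereW \<Longrightarrow> C 0 x = kap d x"
    and C_1: "x \<in> sphereW \<Longrightarrow> C 1 x \<odot> x = phi d x"
    and C_qone: "0 \<le> u \<Longrightarrow> u \<le> 1 \<Longrightarrow> C u qone = qone"

lemma kap_contraction_exists: "\<exists>C. kap_contraction d C"
proof -
  have "homotopic_with_canon (\<lambda>_. True) sphereW (- {0}) (\<lambda>x. kap d x \<odot> x) (phi d)"
    using kap_qmul_self_homotopic kap_phi_homotopic by (rule homotopic_with_trans)
  then obtain D :: "real \<times> complex \<times> complex \<Rightarrow> complex \<times> complex" where D: "continuous_on ({0..1} \<times> sphereW) D"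
    "D \<in> {0..1} \<times> sphereW \<rightarrow> - {0}"
    "\<forall>x. D (0, x) = kap d x \<odot> x" "\<forall>x. D (1, x) = phi d x"
    unfolding homotopic_with_def by (auto simp: image_subset_iff_funcset)
  \<comment> \<open>\<open>sgn\<close> projects the homotopy back to the sphere, and the right
    factor turns \<kappa>(x) x into \<kappa>(x).\<close>
  define E where "E u x = sgn (D (u, x)) \<odot> qinv x" for u x
  have sgn_id: "sgn x = x" if "x \<in> sphereW" for x
    using that by (simp add: sphereW_iff_norm sgn_div_norm)
  have D0: "D (u, x) \<noteq> 0" if "u \<in> {0..1}" "x \<in> sphereW" for u x
    using D(2) that by auto
  have E_in: "E u x \<in> sphereW" if "u \<in> {0..1}" "x \<in> sphereW" for u x
    unfolding E_def using D0[OF that] that(2)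
    by (intro qmul_in qinv_in) (simp_all add: sphereW_iff_norm norm_sgn)
  have contE: "continuous_on ({0..1} \<times> sphereW) (\<lambda>(u, x). E u x)"
    using D0 D(1) unfolding E_def case_prod_beta by (auto intro!: continuous_intros)
  have E0: "E 0 x = kap d x" if "x \<in> sphereW" for x
    using that by (simp add: E_def D(3) sgn_id qmul_assoc)
  have E1: "E 1 x \<odot> x = phi d x" if "x \<in> sphereW" for x
    using that by (simp add: E_def D(4) sgn_id qmul_assoc)
  have E1one: "E 1 qone = qone"
    using E1[of qone] by simp
  have "continuous_on {0..1::real} (\<lambda>u. (u, qone))"
    by (intro continuous_intros)
  from continuous_on_compose2[OF contE this] have "continuous_on {0..1} (\<lambda>u. E u qone)"
    by fastforce
  then have "continuous_on ({0..1} \<times> sphereW) (\<lambda>z. E (fst z) qone)"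
    by (rule continuous_on_compose2) (auto intro!: continuous_intros)
  \<comment> \<open>Dividing by the track of 1 makes the homotopy fix 1; that track is 1 at both
    ends, so these are unchanged.\<close>
  then have "continuous_on ({0..1} \<times> sphereW) (\<lambda>(u, x). E u x \<odot> qinv (E u qone))"
    using contE unfolding case_prod_beta by (intro continuous_intros)
  then have "kap_contraction d (\<lambda>u x. E u x \<odot> qinv (E u qone))"
    by unfold_locales (auto simp: E_in E0 E1 E1one)
  then show ?thesis by (intro exI)
qed

section \<open>The obstruction square\<close>

definition clamp01 :: "real \<Rightarrow> real" where
  "clamp01 t = max 0 (min 1 t)"

lemma clamp01_bounds [simp]: "0 \<le> clamp01 t" "clamp01 t \<le> 1"
  by (simp_all add: clamp01_def)

lemma clamp01_eq: "t \<le> 0 \<Longrightarrow> clamp01 t = 0" "1 \<le> t \<Longrightarrow> clamp01 t = 1"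
    "t \<in> {0..1} \<Longrightarrow> clamp01 t = t"
  by (auto simp: clamp01_def)

lemma continuous_on_clamp01 [continuous_intros]:
  "continuous_on S f \<Longrightarrow> continuous_on S (\<lambda>x. clamp01 (f x))"
  unfolding clamp01_def by (intro continuous_intros)

definition conj_path :: "nat \<Rightarrow> (real \<Rightarrow> complex \<times> complex) \<Rightarrow> bool" where
  "conj_path d Y \<longleftrightarrow> (\<forall>t\<in>{0..1}. Y t \<in> sphereW) \<and> Y 0 = phi d (Y 1)"

lemma conj_path_in [simp]: "conj_path d Y \<Longrightarrow> 0 \<le> t \<Longrightarrow> t \<le> 1 \<Longrightarrow> Y t \<in> sphereW"
  by (simp add: conj_path_def)

lemma conj_path_0: "conj_path d Y \<Longrightarrow> Y 0 = phi d (Y 1)"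
  by (simp add: conj_path_def)

text \<open>Continuity is tested on substituted parameters, the form in which the paths enter
  \<open>contract\<close> and \<open>obloop\<close>.\<close>

definition path_family :: "nat \<Rightarrow> 'z::topological_space set \<Rightarrow> ('z \<Rightarrow> real \<Rightarrow> complex \<times> complex) \<Rightarrow> bool" where
  "path_family d Z K \<longleftrightarrow> (\<forall>z\<in>Z. conj_path d (K z)) \<and>
     (\<forall>u. continuous_on Z u \<longrightarrow> u \<in> Z \<rightarrow> {0..1} \<longrightarrow> continuous_on Z (\<lambda>z. K z (u z)))"

lemma path_familyD:
  assumes "path_family d Z K"
  shows "z \<in> Z \<Longrightarrow> conj_path d (K z)"
    and "continuous_on Z u \<Longrightarrow> u \<in> Z \<rightarrow> {0..1} \<Longrightarrow> continuous_on Z (\<lambda>z. K z (u z))"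
  using assms by (auto simp: path_family_def)

context kap_contraction
begin

text \<open>
  For \<open>Y\<close> running from \<open>\<phi> y\<close> to \<open>y\<close>: \<open>contract Y\<close> leads from \<open>\<kappa> y\<close> to \<open>1\<close> via \<open>\<phi>(y) y\<^sup>-\<^sup>1\<close>
  on \<open>[0, 2]\<close>, and \<open>obloop Y\<close> is the loop on \<open>[-2, 3]\<close> that runs back along \<open>\<phi> (contract Y)\<close>, then along
  \<open>\<kappa> Y\<close>, then along \<open>contract Y\<close>. Concatenations are written as pointwise products with clamped
  parameters, which makes continuity immediate.
\<close>
definition contract :: "(real \<Rightarrow> complex \<times> complex) \<Rightarrow> real \<Rightarrow> complex \<times> complex" where
  "contract Y s = C (clamp01 s) (Y 1) \<odot> Y 1 \<odot> qinv (Y 0) \<odot> Y (clamp01 (s - 1)) \<odot> qinv (Y 1)"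

definition obloop :: "(real \<Rightarrow> complex \<times> complex) \<Rightarrow> real \<Rightarrow> complex \<times> complex" where
  "obloop Y t = phi d (contract Y (- t)) \<odot> qinv (kap d (Y 0)) \<odot> kap d (Y (clamp01 t))
     \<odot> qinv (kap d (Y 1)) \<odot> contract Y (t - 1)"

text \<open>
  In the direction of \<open>s\<close>: first \<open>\<kappa>\<close> of the three sides is spread over \<open>[0, 1]\<close> until the right side is
  \<open>\<kappa> \<theta>\<close> with \<open>\<theta> = obloop Y\<close>; then \<open>C\<close> moves it to \<open>\<phi>(\<theta>) \<theta>\<^sup>-\<^sup>1\<close>; finally
  \<open>\<phi>(\<theta>(max t v)) \<theta>(max t v)\<^sup>-\<^sup>1 \<theta>(v)\<close>
  reaches \<open>1\<close>, being \<open>\<theta>(v)\<close> at the top and \<open>\<phi>(\<theta>(v))\<close> at the bottom.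
\<close>
definition square :: "(real \<Rightarrow> complex \<times> complex) \<Rightarrow> real \<Rightarrow> real \<Rightarrow> complex \<times> complex" where
  "square Y s t =
     (let v = clamp01 (s - 2); m = max t v
      in C (clamp01 (s - 1)) (obloop Y (m + 2 * clamp01 s * (2 * m - 1))) \<odot> obloop Y (5 * v - 2))"

section \<open>Boundary values of the square\<close>

lemma contract_in [simp]: "conj_path d Y \<Longrightarrow> contract Y s \<in> sphereW"
  by (simp add: contract_def C_in)

lemma contract_le_0: "conj_path d Y \<Longrightarrow> s \<le> 0 \<Longrightarrow> contract Y s = kap d (Y 1)"
  by (simp add: contract_def clamp01_eq qmul_assoc C_0)

text \<open>The relation Y 0 = \<phi> (Y 1) enters here: \<open>C 1 (Y 1) \<odot> Y 1\<close> is
  \<phi> (Y 1) and cancels against \<open>qinv (Y 0)\<close>.\<close>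

lemma contract_ge_2: "conj_path d Y \<Longrightarrow> 2 \<le> s \<Longrightarrow> contract Y s = qone"
  by (simp add: contract_def clamp01_eq C_1 conj_path_0 qmul_assoc)

lemma obloop_in [simp]: "conj_path d Y \<Longrightarrow> obloop Y t \<in> sphereW"
  by (simp add: obloop_def)

lemma obloop_le_0: "conj_path d Y \<Longrightarrow> t \<le> 0 \<Longrightarrow> obloop Y t = phi d (contract Y (- t))"
  by (simp add: obloop_def contract_le_0 clamp01_eq qmul_assoc)

lemma obloop_mid: "conj_path d Y \<Longrightarrow> 0 \<le> t \<Longrightarrow> t \<le> 1 \<Longrightarrow> obloop Y t = kap d (Y t)"
  by (simp add: obloop_def contract_le_0 clamp01_eq qmul_assoc conj_path_0 kap_phi)

lemma obloop_ge_1: "conj_path d Y \<Longrightarrow> 1 \<le> t \<Longrightarrow> obloop Y t = contract Y (t - 1)"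
  by (simp add: obloop_def contract_le_0 clamp01_eq qmul_assoc conj_path_0 kap_phi)

lemma obloop_ends: "conj_path d Y \<Longrightarrow> t \<le> -2 \<or> 3 \<le> t \<Longrightarrow> obloop Y t = qone"
  by (auto simp: obloop_le_0 obloop_ge_1 contract_ge_2)

lemma square_in: "conj_path d Y \<Longrightarrow> square Y s t \<in> sphereW"
  by (simp add: square_def Let_def C_in)

lemma square_left:
  assumes "conj_path d Y" "s \<le> 0" "t \<in> {0..1}"
  shows "square Y s t = kap d (kap d (Y t))"
  using assms by (simp add: square_def clamp01_eq obloop_ends obloop_mid C_0 max_absorb1)

lemma square_right:
  assumes "conj_path d Y" "3 \<le> s" "t \<in> {0..1}"
  shows "square Y s t = qone"
  using assms by (simp add: square_def clamp01_eq obloop_ends C_qone)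

text \<open>Each path \<open>square Y s\<close> is thus again a \<open>conj_path\<close>, and the
  square deforms \<kappa> \<circ> \<kappa> \<circ> Y to the constant path 1 through such
  paths.\<close>

lemma square_bottom:
  assumes "conj_path d Y"
  shows "square Y s 0 = phi d (square Y s 1)"
proof -
  consider "s \<le> 1" | "1 \<le> s" "s \<le> 2" | "2 \<le> s" by linarith
  then show ?thesis
  proof cases
    case 1
    have "obloop Y (- (2 * clamp01 s)) = phi d (contract Y (2 * clamp01 s))"
      "obloop Y (1 + 2 * clamp01 s) = contract Y (2 * clamp01 s)"
      using assms by (simp_all add: obloop_le_0 obloop_ge_1)
    with 1 show ?thesis
      using assms contract_in[OF assms]
      by (simp add: square_def clamp01_eq obloop_ends C_0 kap_phi)
  next
    case 2
    then show ?thesis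
      using assms by (simp add: square_def clamp01_eq obloop_ends C_qone)
  next
    case 3
    \<comment> \<open>This maps [0, 1] onto the parameter interval [-2, 3] of the loop. At t = 0 one
      has m = v and the product is \<phi> of the loop at v; at t = 1 the factor with
      \<open>C\<close> is 1.\<close>
    have "m + 2 * (2 * m - 1) = 5 * m - 2" for m :: real by simp
    then show ?thesis
      using assms 3 by (simp add: square_def clamp01_eq obloop_ends C_qone C_1 obloop_in max_absorb1 max_absorb2)
  qed
qed

section \<open>Continuity in families of paths\<close>

lemma continuous_on_C:
  assumes "continuous_on Z u" "u \<in> Z \<rightarrow> {0..1}" "continuous_on Z f" "f \<in> Z \<rightarrow> sphereW"
  shows "continuous_on Z (\<lambda>z. C (u z) (f z))"
  using continuous_on_compose2[OF C_cont continuous_on_Pair[OF assms(1,3)]] assms(2,4)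
  by (fastforce simp: Pi_iff)

lemma continuous_on_contract:
  assumes "path_family d Z K" "continuous_on Z s"
  shows "continuous_on Z (\<lambda>z. contract (K z) (s z))"
  unfolding contract_def using assms conj_path_in[OF path_familyD(1)[OF assms(1)]]
  by (intro continuous_intros continuous_on_C path_familyD(2)[OF assms(1)]) auto

lemma continuous_on_obloop:
  assumes "path_family d Z K" "continuous_on Z t"
  shows "continuous_on Z (\<lambda>z. obloop (K z) (t z))"
  unfolding obloop_def using assms
  by (intro continuous_intros continuous_on_contract[OF assms(1)] path_familyD(2)[OF assms(1)]) auto

lemma continuous_on_square:
  assumes "path_family d Z K" "continuous_on Z s" "continuous_on Z t"
  shows "continuous_on Z (\<lambda>z. square (K z) (s z) (t z))"
  unfolding square_def Let_def using assms path_familyD(1)[OF assms(1)]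
  by (intro continuous_intros continuous_on_C continuous_on_obloop[OF assms(1)])
     auto

end

section \<open>Extending equivariant homotopies\<close>

definition rot :: "complex \<Rightarrow> complex \<Rightarrow> complex \<times> complex \<Rightarrow> complex \<times> complex" where
  "rot a w x = (a * fst x, w * snd x)"

lemma actW_eq_rot: "actW p m t i = rot (t ^ (p ^ m)) (xi p ^ i)"
  by (simp add: actW_def rot_def fun_eq_iff)

lemma rot_rot: "rot a w (rot b v x) = rot (a * b) (w * v) x"
  by (simp add: rot_def)

lemma rot_1 [simp]: "rot 1 1 x = x"
  by (simp add: rot_def)

lemma rot_in [simp]: "cmod a = 1 \<Longrightarrow> cmod w = 1 \<Longrightarrow> x \<in> sphereW \<Longrightarrow> rot a w x \<in> sphereW"
  by (simp add: rot_def sphereW_def norm_mult)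

lemma kap_rot: "cmod a = 1 \<Longrightarrow> kap d (rot a w x) = rot (a ^ d) w (kap d x)"
  by (simp add: kap_def rot_def wind_mult)

lemma phi_rot:
  assumes "w ^ d = 1" "cmod w = 1"
  shows "phi d (rot a w x) = rot a w (phi d x)"
  using assms by (simp add: phi_def rot_def wind_mult)

lemma continuous_on_rot [continuous_intros]:
  "continuous_on S a \<Longrightarrow> continuous_on S w \<Longrightarrow> continuous_on S f
    \<Longrightarrow> continuous_on S (\<lambda>x. rot (a x) (w x) (f x))"
  unfolding rot_def by (intro continuous_intros)

lemma norm_eq_1_if_power_eq_1:
  fixes w :: complex
  assumes "w ^ d = 1" "0 < d"
  shows "cmod w = 1"
proof -
  have "cmod w ^ d = 1 ^ d"
    using assms(1) by (simp flip: norm_power)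
  then show ?thesis
    using assms(2) by (rule power_eq_imp_eq_base[OF _ norm_ge_zero zero_le_one])
qed

lemma xi_power: "0 < p \<Longrightarrow> xi p ^ p = 1"
  by (simp add: xi_def flip: exp_of_nat_mult)

lemma norm_xi [simp]: "0 < p \<Longrightarrow> cmod (xi p) = 1"
  by (rule norm_eq_1_if_power_eq_1[OF xi_power])

lemma xi_power_power:
  assumes "0 < p" "0 < k"
  shows "(xi p ^ i) ^ (p ^ k) = 1"
proof -
  have "i * p ^ k = p * (i * p ^ (k - 1))"
    using assms(2) by (cases k) simp_all
  then have "(xi p ^ i) ^ (p ^ k) = (xi p ^ p) ^ (i * p ^ (k - 1))"
    by (simp only: power_mult[symmetric])
  then show ?thesis
    using assms(1) by (simp add: xi_power)
qed

text \<open>A G-homotopy over \<open>A\<close> from \<phi> \<circ> f to f, where f is the G-map z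
  |-> \<open>H z 1\<close>.\<close>

definition phi_homotopy ::
  "nat \<Rightarrow> nat \<Rightarrow> nat \<Rightarrow> (nat \<Rightarrow> complex) set \<Rightarrow> ((nat \<Rightarrow> complex) \<Rightarrow> real \<Rightarrow> complex \<times> complex) \<Rightarrow> bool" where
  "phi_homotopy p n m A H \<longleftrightarrow>
     continuous_on (A \<times> {0..1}) (\<lambda>(z, s). H z s) \<and>
     (\<forall>z\<in>A. conj_path p (H z)) \<and>
     (\<forall>t i z s. cmod t = 1 \<longrightarrow> z \<in> A \<longrightarrow> 0 \<le> s \<longrightarrow> s \<le> 1 \<longrightarrow>
        H (actV p n t i z) s = actW p m t i (H z s))"

text \<open>Where \<sigma> > 0 the pair (a, w) maps to an orbit. Where also M > 0, dividing by it
  turns H into an invariant family of paths, which \<open>square\<close>, after \<kappa> twice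
  (hence m + 2), deforms to a constant. Multiplying back joins \<kappa> \<circ> \<kappa> \<circ> H
  to an orbit map defined wherever \<sigma> > 0.\<close>

lemma phi_homotopy_extend:
  fixes M \<sigma> :: "(nat \<Rightarrow> complex) \<Rightarrow> real" and a w :: "(nat \<Rightarrow> complex) \<Rightarrow> complex"
  assumes p: "0 < p"
    and H: "phi_homotopy p n m {z \<in> sphereV n. 0 < M z} H"
    and M: "continuous_on (sphereV n) M" "\<And>z. z \<in> sphereV n \<Longrightarrow> 0 \<le> M z"
      "\<And>t i z. cmod t = 1 \<Longrightarrow> z \<in> sphereV n \<Longrightarrow> M (actV p n t i z) = M z"
    and \<sigma>: "continuous_on (sphereV n) \<sigma>" "\<And>z. z \<in> sphereV n \<Longrightarrow> 0 \<le> \<sigma> z"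
      "\<And>t i z. cmod t = 1 \<Longrightarrow> z \<in> sphereV n \<Longrightarrow> \<sigma> (actV p n t i z) = \<sigma> z"
    and a: "continuous_on {z \<in> sphereV n. 0 < \<sigma> z} a"
      "\<And>z. z \<in> sphereV n \<Longrightarrow> 0 < \<sigma> z \<Longrightarrow> cmod (a z) = 1"
      "\<And>t i z. cmod t = 1 \<Longrightarrow> z \<in> sphereV n \<Longrightarrow> 0 < \<sigma> z \<Longrightarrow> a (actV p n t i z) = t ^ (p ^ m) * a z"
    and w: "continuous_on {z \<in> sphereV n. 0 < \<sigma> z} w"
      "\<And>z. z \<in> sphereV n \<Longrightarrow> 0 < \<sigma> z \<Longrightarrow> w z ^ p = 1"
      "\<And>t i z. cmod t = 1 \<Longrightarrow> z \<in> sphereV n \<Longrightarrow> 0 < \<sigma> z \<Longrightarrow> w (actV p n t i z) = xi p ^ i * w z"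
  shows "\<exists>H'. phi_homotopy p n (m + 2) {z \<in> sphereV n. 0 < M z + \<sigma> z} H'"
proof -
  obtain C where "kap_contraction p C"
    using kap_contraction_exists by blast
  then interpret kap_contraction p C by simp
  define A1 where "A1 = {z \<in> sphereV n. 0 < M z}"
  define A2 where "A2 = {z \<in> sphereV n. 0 < \<sigma> z}"
  define A where "A = {z \<in> sphereV n. 0 < M z + \<sigma> z}"
  have Hc: "continuous_on (A1 \<times> {0..1}) (\<lambda>(z, s). H z s)"
    using H by (simp add: phi_homotopy_def A1_def)
  have Hp: "conj_path p (H z)" if "z \<in> A1" for z
    using H that by (simp add: phi_homotopy_def A1_def)
  have He: "H (actV p n t i z) s = actW p m t i (H z s)"
    if "cmod t = 1" "z \<in> A1" "0 \<le> s" "s \<le> 1" for t i z s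
    using H that by (auto simp: phi_homotopy_def A1_def)
  have w1: "cmod (w z) = 1" if "z \<in> A2" for z
    using norm_eq_1_if_power_eq_1[OF w(2) p] that by (simp add: A2_def)
  have a1: "cmod (a z) = 1" and wp: "w z ^ p = 1" if "z \<in> A2" for z
    using a(2) w(2) that by (simp_all add: A2_def)
  have nz: "a z \<noteq> 0" "w z \<noteq> 0" if "z \<in> A2" for z
    using a1[OF that] w1[OF that] by auto
  define K where "K z s = rot (inverse (a z)) (inverse (w z)) (H z s)" for z s
  \<comment> \<open>This is 0 where M = 2 \<sigma> and 3 where \<sigma> = 2 M: the left and right
    sides of the square.\<close>
  define r where "r z = 3 * (2 * \<sigma> z - M z) / (\<sigma> z + M z)" for z
  define H1 where "H1 z s = kap p (kap p (H z s))" for z s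
  \<comment> \<open>Applying \<kappa> twice raises the first rotation factor to the power p^2; this
    lets \<open>H3\<close> meet \<open>H1\<close> on the left side.\<close>
  define H2 where "H2 z = rot (a z ^ (p ^ 2)) (w z) qone" for z
  define H3 where "H3 z s = rot (a z ^ (p ^ 2)) (w z) (square (K z) (r z) s)" for z s
  \<comment> \<open>The closures in \<open>A\<close> of the three regions lie in \<open>A1\<close>,
    in \<open>A2\<close> and in \<open>A1 \<inter> A2\<close>, so each branch is continuous up to
    its boundary.\<close>
  define H' where "H' z s = (if \<sigma> z - M z / 2 \<le> 0 then H1 z s
     else if M z - \<sigma> z / 2 \<le> 0 then H2 z else H3 z s)" for z s
  have Kp: "conj_path p (K z)" if "z \<in> A1 \<inter> A2" for z
    using Hp[of z] that a1[of z] w1[of z] wp[of z]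
    by (auto simp: conj_path_def K_def norm_inverse phi_rot power_inverse)
  have A12: "z \<in> A1" if "z \<in> A" "\<sigma> z \<le> M z / 2 \<or> \<sigma> z / 2 \<le> M z" for z
    using that M(2)[of z] \<sigma>(2)[of z] by (auto simp: A_def A1_def)
  have A22: "z \<in> A2" if "z \<in> A" "M z / 2 \<le> \<sigma> z \<or> M z \<le> \<sigma> z / 2" for z
    using that M(2)[of z] \<sigma>(2)[of z] by (auto simp: A_def A2_def)
  have cfst: "continuous_on Z fst" for Z :: "((nat \<Rightarrow> complex) \<times> real) set"
    by (rule continuous_on_fst[OF continuous_on_id])
  have cM: "continuous_on Z (\<lambda>x. M (fst x))" and c\<sigma>: "continuous_on Z (\<lambda>x. \<sigma> (fst x))"
    if "Z \<subseteq> A \<times> {0..1}" for Z :: "((nat \<Rightarrow> complex) \<times> real) set"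
    using that unfolding A_def
    by (auto intro!: continuous_on_compose2[OF M(1) cfst] continuous_on_compose2[OF \<sigma>(1) cfst])
  have ca: "continuous_on Z (\<lambda>x. a (fst x))" and cw: "continuous_on Z (\<lambda>x. w (fst x))"
    if "Z \<subseteq> A2 \<times> {0..1}" for Z :: "((nat \<Rightarrow> complex) \<times> real) set"
    using that unfolding A2_def
    by (auto intro!: continuous_on_compose2[OF a(1) cfst] continuous_on_compose2[OF w(1) cfst])
  have cH: "continuous_on Z (\<lambda>x. H (fst x) (u x))"
    if "Z \<subseteq> A1 \<times> {0..1}" "continuous_on Z u" "u \<in> Z \<rightarrow> {0..1}"
    for Z :: "((nat \<Rightarrow> complex) \<times> real) set" and u
  proof -
    have "continuous_on Z (\<lambda>x. (fst x, u x))"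
      using that(2) by (intro continuous_on_Pair cfst)
    from continuous_on_compose2[OF Hc this] show ?thesis
      using that by fastforce
  qed
  have cH3: "continuous_on Z (\<lambda>x. H3 (fst x) (snd x))" if Z: "Z \<subseteq> (A1 \<inter> A2) \<times> {0..1}" "Z \<subseteq> A \<times> {0..1}" for Z
  proof -
    have "path_family p Z (\<lambda>x. K (fst x))"
      unfolding path_family_def
    proof (intro conjI ballI allI impI)
      show "conj_path p (K (fst x))" if "x \<in> Z" for x
        using Z that by (intro Kp) auto
      show "continuous_on Z (\<lambda>x. K (fst x) (u x))"
        if "continuous_on Z u" "u \<in> Z \<rightarrow> {0..1}" for u
        unfolding K_def using Z that nz
        by (intro continuous_intros cH ca cw) auto
    qed
    then show ?thesis
      unfolding H3_def r_def using Z
      by (intro continuous_intros ca cw continuous_on_square cM c\<sigma>) (auto simp: A_def)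
  qed
  have cH': "continuous_on (A \<times> {0..1}) (\<lambda>x. H' (fst x) (snd x))"
    unfolding H'_def
  proof (intro continuous_on_cases_le)
    show "continuous_on {x \<in> A \<times> {0..1}. \<sigma> (fst x) - M (fst x) / 2 \<le> 0} (\<lambda>x. H1 (fst x) (snd x))"
      unfolding H1_def using A12
      by (intro continuous_intros cH) auto
    show "continuous_on {x \<in> {x \<in> A \<times> {0..1::real}. 0 \<le> \<sigma> (fst x) - M (fst x) / 2}. M (fst x) - \<sigma> (fst x) / 2 \<le> 0}
            (\<lambda>x. H2 (fst x))"
      unfolding H2_def using A22
      by (intro continuous_intros ca cw) auto
    show "continuous_on {x \<in> {x \<in> A \<times> {0..1::real}. 0 \<le> \<sigma> (fst x) - M (fst x) / 2}. 0 \<le> M (fst x) - \<sigma> (fst x) / 2}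
            (\<lambda>x. H3 (fst x) (snd x))"
      using A12 A22 by (intro cH3) auto
    show "H2 (fst x) = H3 (fst x) (snd x)"
      if "x \<in> {x \<in> A \<times> {0..1::real}. 0 \<le> \<sigma> (fst x) - M (fst x) / 2}" "M (fst x) - \<sigma> (fst x) / 2 = 0" for x
    proof -
      have "fst x \<in> A" "0 \<le> snd x" "snd x \<le> 1" "\<sigma> (fst x) = 2 * M (fst x)" using that by auto
      moreover from this have "r (fst x) = 3" 
        by (auto simp: r_def A_def field_simps)
      ultimately show ?thesis
        using Kp[of "fst x"] A12[of "fst x"] A22[of "fst x"] M(2)[of "fst x"]
        by (simp add: H2_def H3_def square_right A_def)
    qed
    show "H1 (fst x) (snd x) = (if M (fst x) - \<sigma> (fst x) / 2 \<le> 0 then H2 (fst x) else H3 (fst x) (snd x))"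
      if "x \<in> A \<times> {0..1}" "\<sigma> (fst x) - M (fst x) / 2 = 0" for x
    proof -
      have x: "fst x \<in> A" "0 \<le> snd x" "snd x \<le> 1" "M (fst x) = 2 * \<sigma> (fst x)" using that by auto
      then have x2: "0 < \<sigma> (fst x)" "r (fst x) = 0"
        by (auto simp: r_def A_def field_simps)
      have x3: "fst x \<in> A1 \<inter> A2"
        using x x2 by (auto simp: A_def A1_def A2_def)
      have "H3 (fst x) (snd x) = H1 (fst x) (snd x)"
        using Kp[OF x3] x x2 x3 nz[of "fst x"] a1[of "fst x"]
        by (simp add: H3_def H1_def square_left K_def kap_rot norm_inverse norm_power rot_rot
            power2_eq_square power_mult power_inverse flip: power_mult_distrib)
      then show ?thesis using x x2 by simp
    qed
  qed (auto intro!: continuous_intros cM c\<sigma>)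
  have "phi_homotopy p n (m + 2) A H'"
    unfolding phi_homotopy_def
  proof (intro conjI ballI allI impI)
    show "continuous_on (A \<times> {0..1}) (\<lambda>(z, s). H' z s)"
      using cH' by (simp add: case_prod_beta)
  next
    fix z assume z: "z \<in> A"
    consider (1) "\<sigma> z - M z / 2 \<le> 0" | (2) "\<not> \<sigma> z - M z / 2 \<le> 0" "M z - \<sigma> z / 2 \<le> 0"
      | (3) "\<not> \<sigma> z - M z / 2 \<le> 0" "\<not> M z - \<sigma> z / 2 \<le> 0" by blast
    then show "conj_path p (H' z)"
    proof cases
      case 1
      then have "z \<in> A1" using A12 z by auto
      then show ?thesis
        using Hp[of z] 1 by (simp add: conj_path_def H'_def H1_def kap_phi)
    next
      case 2
      then have "z \<in> A2" using A22 z by auto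
      then show ?thesis
        using 2 a1 w1 wp by (simp add: conj_path_def H'_def H2_def phi_rot norm_power)
    next
      case 3
      then have "z \<in> A1" "z \<in> A2" using A12 A22 z by auto
      then show ?thesis
        using 3 a1 w1 wp Kp[of z]
        by (simp add: conj_path_def H'_def H3_def phi_rot norm_power square_in square_bottom)
    qed
  next
    fix t i z s assume t: "cmod t = 1" and z: "z \<in> A" and s: "0 \<le> (s::real)" "s \<le> 1"
    have zS: "z \<in> sphereV n" using z by (simp add: A_def)
    let ?g = "actV p n t i z"
    have M': "M ?g = M z" and \<sigma>': "\<sigma> ?g = \<sigma> z" using M(3) \<sigma>(3) t zS by auto
    have t0: "t \<noteq> 0" using t by auto
    have x0: "xi p \<noteq> 0" using norm_xi[OF p] by auto
    have pm: "(t ^ (p ^ m)) ^ (p ^ 2) = t ^ (p ^ (m + 2))"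
      by (simp add: power2_eq_square mult_ac flip: power_mult)
    have aw: "a ?g = t ^ (p ^ m) * a z" "w ?g = xi p ^ i * w z" if "z \<in> A2"
      using a(3) w(3) t that by (auto simp: A2_def)
    have inv: "inverse (c * b) * c = inverse b" if "c \<noteq> 0" for b c :: complex
      using that by (simp add: field_simps)
    have Kg: "K ?g u = K z u" if "z \<in> A1" "z \<in> A2" "0 \<le> u" "u \<le> 1" for u
      using He[OF t that(1,3,4)] aw[OF that(2)] nz[OF that(2)] t0 x0
      by (simp add: K_def actW_eq_rot rot_rot inv del: inverse_mult_distrib)
    consider (1) "\<sigma> z - M z / 2 \<le> 0" | (2) "\<not> \<sigma> z - M z / 2 \<le> 0" "M z - \<sigma> z / 2 \<le> 0"
      | (3) "\<not> \<sigma> z - M z / 2 \<le> 0" "\<not> M z - \<sigma> z / 2 \<le> 0" by blast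
    then show "H' ?g s = actW p (m + 2) t i (H' z s)"
    proof cases
      case 1
      then have "z \<in> A1" using A12 z by auto
      then show ?thesis
        using 1 M' \<sigma>' He[OF t _ s] t pm
        by (simp add: H'_def H1_def actW_eq_rot kap_rot norm_power power2_eq_square power_mult)
    next
      case 2
      then have "z \<in> A2" using A22 z by auto
      then show ?thesis
        using 2 M' \<sigma>' aw pm by (simp add: H'_def H2_def actW_eq_rot rot_rot power_mult_distrib)
    next
      case 3
      then have z12: "z \<in> A1" "z \<in> A2" using A12 A22 z by auto
      \<comment> \<open>\<open>square\<close> evaluates its path only at parameters in [0, 1], where
        the two paths agree.\<close>
      have "square (K ?g) (r z) s = square (K z) (r z) s"
        using Kg[OF z12] by (simp add: square_def obloop_def contract_def)
      then show ?thesis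
        using 3 M' \<sigma>' aw[OF z12(2)] pm
        by (simp add: H'_def H3_def actW_eq_rot rot_rot power_mult_distrib r_def)
    qed
  qed
  then show ?thesis unfolding A_def by blast
qed

section \<open>Charts off the coordinate circles\<close>

lemma continuous_on_coord [continuous_intros]:
  "continuous_on S (\<lambda>z. z i)" for S :: "(nat \<Rightarrow> complex) set"
  by (rule continuous_on_product_then_coordinatewise) simp

definition cross :: "nat \<Rightarrow> nat \<Rightarrow> nat \<Rightarrow> (nat \<Rightarrow> complex) \<Rightarrow> complex" where
  "cross p i j z = z j * cnj (z i) ^ (p ^ (j - i))"

text \<open>
  For \<open>e = 1\<close> or \<open>e = -1\<close> the chart is positive exactly where \<open>e U\<^sup>p\<close>, for \<open>U = cross p i j z\<close>, lies off the
  closed negative real axis, so that \<open>U\<^sup>p\<close> has a continuous \<open>p\<close>-th root there.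
\<close>
definition chart :: "nat \<Rightarrow> nat \<times> nat \<times> real \<Rightarrow> (nat \<Rightarrow> complex) \<Rightarrow> real" where
  "chart p = (\<lambda>(i, j, e) z. cmod (cross p i j z ^ p) + e * Re (cross p i j z ^ p))"

text \<open>With the threshold 1/2 at most one summand is nonzero on
  \<open>sphereV n\<close>.\<close>

definition axis_bump :: "nat \<Rightarrow> (nat \<Rightarrow> complex) \<Rightarrow> real" where
  "axis_bump n z = (\<Sum>i<n. max 0 ((cmod (z i))\<^sup>2 - 1 / 2))"

text \<open>The weights p^j and - p^i p^(j - i) of t cancel, and the conjugate factor contributes no
  power of \<open>xi p\<close> because p divides p^(j - i).\<close>

lemma cross_actV:
  assumes "0 < p" "cmod t = 1" "i < j" "j < n"
  shows "cross p i j (actV p n t k z) = xi p ^ k * cross p i j z"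
proof -
  have t: "t ^ N * cnj t ^ N = 1" for N
    using complex_norm_square[of t] assms(2) by (simp flip: power_mult_distrib)
  have e: "p ^ i * p ^ (j - i) = p ^ j"
    using assms(3) by (simp flip: power_add)
  have x: "(cnj (xi p) ^ k) ^ (p ^ (j - i)) = 1"
    using arg_cong[OF xi_power_power[of p "j - i" k], of cnj] assms by simp
  have "cross p i j (actV p n t k z) =
      (t ^ (p ^ j) * cnj t ^ (p ^ i * p ^ (j - i))) * (cnj (xi p) ^ k) ^ (p ^ (j - i)) * (xi p ^ k * cross p i j z)"
    using assms by (simp add: cross_def actV_def power_mult_distrib flip: power_mult)
  then show ?thesis by (simp only: e t x mult_1)
qed

lemma chart_actV:
  assumes "0 < p" "cmod t = 1" "i < j" "j < n"
  shows "chart p (i, j, e) (actV p n t k z) = chart p (i, j, e) z"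
  using assms xi_power[of p]
  by (simp add: chart_def cross_actV power_mult_distrib flip: power_mult)
     (simp add: mult.commute[of k] power_mult)

lemma chart_nonneg: "\<bar>e\<bar> = 1 \<Longrightarrow> 0 \<le> chart p (i, j, e) z"
  using abs_Re_le_cmod[of "cross p i j z ^ p"] by (auto simp: chart_def abs_if split: if_splits)

lemma continuous_on_chart: "continuous_on S (chart p c)"
  by (cases c) (auto simp: chart_def cross_def intro!: continuous_intros)

lemma continuous_on_axis_bump: "continuous_on S (axis_bump n)"
  unfolding axis_bump_def by (intro continuous_intros)

lemma axis_bump_actV: "0 < p \<Longrightarrow> cmod t = 1 \<Longrightarrow> axis_bump n (actV p n t k z) = axis_bump n z"
  by (simp add: axis_bump_def actV_def norm_mult norm_power)

lemma axis_bump_nonneg: "0 \<le> axis_bump n z"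
  by (simp add: axis_bump_def sum_nonneg)

text \<open>Near the i-th coordinate circle the map is the phase of z_i^(p^(n - i)), of weight p^n
  for every i, with second coordinate 0. Such points are fixed by \<phi>, so the homotopy is
  constant.\<close>

lemma phi_homotopy_axis_bump:
  assumes p: "0 < p"
  shows "\<exists>H. phi_homotopy p n n {z \<in> sphereV n. 0 < axis_bump n z} H"
proof -
  define G where "G z = (\<Sum>i<n. of_real (max 0 ((cmod (z i))\<^sup>2 - 1 / 2)) * z i ^ (p ^ (n - i)))"
    for z :: "nat \<Rightarrow> complex"
  have G0: "G z \<noteq> 0" if z: "z \<in> sphereV n" "0 < axis_bump n z" for z
  proof -
    have "\<exists>i<n. 1 / 2 < (cmod (z i))\<^sup>2"
    proof (rule ccontr)
      assume no: "\<not> ?thesis"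
      have "max 0 ((cmod (z i))\<^sup>2 - 1 / 2) = 0" if "i < n" for i
      proof -
        have "(cmod (z i))\<^sup>2 \<le> 1 / 2"
          using no \<open>i < n\<close> that by (meson not_le)
        then show ?thesis by simp
      qed
      then show False using z(2) by (simp add: axis_bump_def)
    qed
    then obtain i where i: "i < n" "1 / 2 < (cmod (z i))\<^sup>2" by blast
    have "(\<Sum>j\<in>{..<n} - {i}. (cmod (z j))\<^sup>2) = 1 - (cmod (z i))\<^sup>2"
      using z(1) i(1) by (simp add: sphereV_def sum_diff1)
    moreover have "(cmod (z j))\<^sup>2 \<le> (\<Sum>j\<in>{..<n} - {i}. (cmod (z j))\<^sup>2)" if "j < n" "j \<noteq> i" for j
      using that by (intro member_le_sum) auto
    ultimately have "(cmod (z j))\<^sup>2 < 1 / 2" if "j < n" "j \<noteq> i" for j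
      using that i(2) by fastforce
    then have "max 0 ((cmod (z j))\<^sup>2 - 1 / 2) = 0" if "j < n" "j \<noteq> i" for j
      using that by (force simp: max_def)
    then have "G z = (\<Sum>j<n. if j = i then of_real ((cmod (z i))\<^sup>2 - 1 / 2) * z i ^ (p ^ (n - i)) else 0)"
      unfolding G_def using i(2) by (intro sum.cong) (auto simp: max_absorb2)
    also have "\<dots> = of_real ((cmod (z i))\<^sup>2 - 1 / 2) * z i ^ (p ^ (n - i))"
      using i(1) by simp
    finally have "G z = of_real ((cmod (z i))\<^sup>2 - 1 / 2) * z i ^ (p ^ (n - i))" .
    moreover have "of_real ((cmod (z i))\<^sup>2 - 1 / 2) \<noteq> (0::complex)"
      using i(2) by (simp only: of_real_eq_0_iff)
    moreover have "z i \<noteq> 0" using i(2) by auto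
    ultimately show ?thesis by simp
  qed
  have Ga: "G (actV p n t k z) = t ^ (p ^ n) * G z" if t: "cmod t = 1" for t k z
  proof -
    have "actV p n t k z i ^ (p ^ (n - i)) = t ^ (p ^ n) * z i ^ (p ^ (n - i))" if "i < n" for i
    proof -
      have "p ^ i * p ^ (n - i) = p ^ n" using that by (simp flip: power_add)
      then show ?thesis
        using that p xi_power_power[of p "n - i" k]
        by (simp add: actV_def power_mult_distrib flip: power_mult)
    qed
    then show ?thesis
      unfolding G_def sum_distrib_left
      using t p by (intro sum.cong) (auto simp: actV_def norm_mult norm_power)
  qed
  have sgn_G: "cmod (sgn (G z)) = 1" if "z \<in> sphereV n" "0 < axis_bump n z" for z
    using G0[OF that] by (simp add: norm_sgn)
  have sgn_Ga: "sgn (G (actV p n t k z)) = t ^ (p ^ n) * sgn (G z)" if "cmod t = 1" for t k z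
    using that by (simp add: Ga sgn_mult sgn_eq[of "t ^ _"] norm_power)
  have "phi_homotopy p n n {z \<in> sphereV n. 0 < axis_bump n z} (\<lambda>z s. (sgn (G z), 0))"
    unfolding phi_homotopy_def
  proof (intro conjI ballI allI impI)
    show "continuous_on ({z \<in> sphereV n. 0 < axis_bump n z} \<times> {0..1::real}) (\<lambda>(z, s). (sgn (G z), 0))"
    proof -
      have "continuous_on {z \<in> sphereV n. 0 < axis_bump n z} (\<lambda>z. sgn (G z))"
        using G0 unfolding G_def by (intro continuous_intros) auto
      then have "continuous_on ({z \<in> sphereV n. 0 < axis_bump n z} \<times> {0..1::real}) (\<lambda>x. sgn (G (fst x)))"
        by (rule continuous_on_compose2) (auto intro!: continuous_on_fst[OF continuous_on_id])
      then show ?thesis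
        unfolding case_prod_beta by (intro continuous_on_Pair continuous_on_const)
    qed
  qed (use sgn_G sgn_Ga in \<open>auto simp: conj_path_def phi_def sphereW_def actW_def wind_def\<close>)
  then show ?thesis by (intro exI)
qed

text \<open>The map to an orbit consists of the phase of z_i to the power p^(m - i) and of U / R,
  with U = \<open>cross p i j z\<close> and R a continuous p-th root of U^p. As R depends on U^p
  only, it is invariant, and U / R is a p-th root of unity on which a acts by \<xi>.\<close>

lemma phi_homotopy_add_chart:
  assumes p: "0 < p" and ij: "i < j" "j < n" and e: "\<bar>e\<bar> = 1" and m: "n \<le> m"
    and H: "phi_homotopy p n m {z \<in> sphereV n. 0 < M z} H"
    and M: "continuous_on (sphereV n) M" "\<And>z. z \<in> sphereV n \<Longrightarrow> 0 \<le> M z"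
      "\<And>t k z. cmod t = 1 \<Longrightarrow> z \<in> sphereV n \<Longrightarrow> M (actV p n t k z) = M z"
  shows "\<exists>H'. phi_homotopy p n (m + 2) {z \<in> sphereV n. 0 < M z + chart p (i, j, e) z} H'"
proof -
  \<comment> \<open>A p-th root of the sign e, which undoes the factor e under the
    logarithm.\<close>
  obtain \<rho> :: complex where \<rho>: "\<rho> ^ p = of_real e"
  proof -
    have "cis (pi / p) ^ p = -1"
      using p by (simp add: Complex.DeMoivre)
    then show ?thesis
      using e that[of 1] that[of "cis (pi / p)"] by (auto simp: abs_if split: if_splits)
  qed
  let ?U = "cross p i j"
  define R where "R z = \<rho> * exp (Ln (of_real e * ?U z ^ p) / of_nat p)" for z
  have U0: "?U z \<noteq> 0" and nonpos: "of_real e * ?U z ^ p \<notin> \<real>\<^sub>\<le>\<^sub>0" and R: "R z ^ p = ?U z ^ p"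
    if "0 < chart p (i, j, e) z" for z
  proof -
    show U: "?U z \<noteq> 0" using that p by (auto simp: chart_def zero_power)
    show "of_real e * ?U z ^ p \<notin> \<real>\<^sub>\<le>\<^sub>0"
    proof
      assume "of_real e * ?U z ^ p \<in> \<real>\<^sub>\<le>\<^sub>0"
      then obtain x where x: "of_real e * ?U z ^ p = of_real x" "x \<le> 0"
        by (auto elim: nonpos_Reals_cases)
      have "cmod (?U z ^ p) = - x" 
        using arg_cong[OF x(1), of cmod] x(2) e by (simp add: norm_mult)
      moreover have "e * Re (?U z ^ p) = x"
        using arg_cong[OF x(1), of Re] by simp
      ultimately show False using that by (simp add: chart_def)
    qed
    have "e \<noteq> 0" "e * e = 1" using e by (auto simp: abs_if split: if_splits)
    have "exp (Ln (of_real e * ?U z ^ p) / of_nat p) ^ p = of_real e * ?U z ^ p"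
      using p U \<open>e \<noteq> 0\<close> by (simp flip: exp_of_nat_mult)
    then have "R z ^ p = of_real (e * e) * ?U z ^ p"
      by (simp add: R_def power_mult_distrib \<rho>)
    then show "R z ^ p = ?U z ^ p" using \<open>e * e = 1\<close> by simp
  qed
  have R0: "R z \<noteq> 0" if "0 < chart p (i, j, e) z" for z
    using R[OF that] U0[OF that] p by (auto simp: zero_power)
  have zi: "z i \<noteq> 0" if "0 < chart p (i, j, e) z" for z
    using U0[OF that] p by (auto simp: cross_def)
  have Ract: "R (actV p n t k z) = R z" if "cmod t = 1" for t k z
  proof -
    have "(xi p ^ k) ^ p = 1"
      using xi_power_power[of p 1 k] p by simp
    then show ?thesis
      using that p ij by (simp add: R_def cross_actV power_mult_distrib)
  qed
  \<comment> \<open>As m - i is positive, p divides p^(m - i) and the action of a on the phase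
    disappears.\<close>
  have im: "p ^ i * p ^ (m - i) = p ^ m" "0 < m - i"
    using ij m by (simp_all flip: power_add)
  show ?thesis
  proof (rule phi_homotopy_extend[OF p H M])
    show "continuous_on (sphereV n) (chart p (i, j, e))" "\<And>z. 0 \<le> chart p (i, j, e) z"
      by (fact continuous_on_chart, fact chart_nonneg[OF e])
    show "chart p (i, j, e) (actV p n t k z) = chart p (i, j, e) z" if "cmod t = 1" for t k z
      using that p ij by (simp add: chart_actV)
    show "continuous_on {z \<in> sphereV n. 0 < chart p (i, j, e) z} (\<lambda>z. sgn (z i) ^ (p ^ (m - i)))"
      using zi by (intro continuous_intros) auto
    show "cmod (sgn (z i) ^ (p ^ (m - i))) = 1" if "0 < chart p (i, j, e) z" for z
      using zi[OF that] by (simp add: norm_power norm_sgn)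
    show "sgn (actV p n t k z i) ^ (p ^ (m - i)) = t ^ (p ^ m) * sgn (z i) ^ (p ^ (m - i))"
      if "cmod t = 1" for t k z
      using that ij p xi_power_power[OF p im(2), of k]
      by (simp add: actV_def sgn_mult sgn_eq norm_power norm_mult power_mult_distrib power_divide im(1) flip: power_mult)
    show "continuous_on {z \<in> sphereV n. 0 < chart p (i, j, e) z} (\<lambda>z. ?U z / R z)"
    proof -
      have c: "continuous_on S ?U" for S
        unfolding cross_def by (intro continuous_intros)
      show ?thesis
        using R0 nonpos p unfolding R_def by (intro continuous_intros c) auto
    qed
    show "(?U z / R z) ^ p = 1" if "0 < chart p (i, j, e) z" for z
      using R[OF that] U0[OF that] by (simp add: power_divide)
    show "?U (actV p n t k z) / R (actV p n t k z) = xi p ^ k * (?U z / R z)" if "cmod t = 1" for t k z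
      using that p ij by (simp add: Ract cross_actV)
  qed
qed

text \<open>If z_i and z_j are nonzero, the charts for e = 1 and e = -1 sum to 2 |U^p| > 0;
  otherwise z lies on a coordinate circle, where the bump is 1/2.\<close>

lemma axis_or_chart_pos:
  assumes p: "0 < p" and z: "z \<in> sphereV n"
  shows "0 < axis_bump n z \<or> (\<exists>i j e. i < j \<and> j < n \<and> \<bar>e\<bar> = 1 \<and> 0 < chart p (i, j, e) z)"
proof (cases "\<exists>i j. i < j \<and> j < n \<and> z i \<noteq> 0 \<and> z j \<noteq> 0")
  case True
  then obtain i j where ij: "i < j" "j < n" "z i \<noteq> 0" "z j \<noteq> 0" by blast
  then have "0 < cmod (cross p i j z ^ p)"
    by (simp add: cross_def)
  then have "0 < chart p (i, j, 1) z + chart p (i, j, - 1) z"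
    by (simp add: chart_def)
  then have "0 < chart p (i, j, 1) z \<or> 0 < chart p (i, j, - 1) z"
    by linarith
  then show ?thesis using ij by (metis abs_minus abs_one)
next
  case False
  have "\<exists>i<n. z i \<noteq> 0"
  proof (rule ccontr)
    assume "\<not> ?thesis"
    then have "(\<Sum>j<n. (cmod (z j))\<^sup>2) = 0" by simp
    then show False using z by (simp add: sphereV_def)
  qed
  then obtain i where i: "i < n" "z i \<noteq> 0" by blast
  have "z j = 0" if "j < n" "j \<noteq> i" for j
    using False i that by (metis nat_neq_iff)
  then have "(\<Sum>j<n. (cmod (z j))\<^sup>2) = (\<Sum>j<n. if j = i then (cmod (z i))\<^sup>2 else 0)"
    by (intro sum.cong) auto
  then have "(cmod (z i))\<^sup>2 = 1"
    using z i(1) by (simp add: sphereV_def)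
  moreover have "max 0 ((cmod (z i))\<^sup>2 - 1 / 2) \<le> axis_bump n z"
    unfolding axis_bump_def using i(1) by (intro member_le_sum) auto
  ultimately show ?thesis by simp
qed

theorem theorem2p1:
  fixes p n :: nat
  assumes "prime p" and "n \<ge> 1"
  shows "\<exists>m\<ge>n. \<exists>f :: (nat \<Rightarrow> complex) \<Rightarrow> complex \<times> complex.
           continuous_on (sphereV n) f \<and> f ` sphereV n \<subseteq> sphereW \<and>
           (\<forall>t i z. cmod t = 1 \<longrightarrow> z \<in> sphereV n \<longrightarrow>
                f (actV p n t i z) = actW p m t i (f z))"
proof -
  have p: "0 < p" using assms(1) by (rule prime_gt_0_nat)
  define I where "I = {(i, j, e). i < j \<and> j < n \<and> \<bar>e\<bar> = (1::real)}"
  have "I \<subseteq> {..<n} \<times> {..<n} \<times> {1, - 1}"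
    by (auto simp: I_def abs_if split: if_splits)
  then have finI: "finite I" by (rule finite_subset) simp
  define M where "M J z = axis_bump n z + (\<Sum>c\<in>J. chart p c z)" for J z
  have M_nonneg: "0 \<le> M J z" if "J \<subseteq> I" for J z
    unfolding M_def using that
    by (intro add_nonneg_nonneg sum_nonneg axis_bump_nonneg) (auto simp: I_def chart_nonneg)
  have M_act: "M J (actV p n t k z) = M J z" if "J \<subseteq> I" "cmod t = 1" for J t k z
    unfolding M_def using that p
    by (intro arg_cong2[where f = "(+)"] axis_bump_actV sum.cong) (auto simp: I_def chart_actV)
  \<comment> \<open>Induction over the charts: m starts at n near the coordinate circles, and each
    chart raises it by 2.\<close>
  have "\<exists>m\<ge>n. \<exists>H. phi_homotopy p n m {z \<in> sphereV n. 0 < M J z} H" if "finite J" "J \<subseteq> I" for J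
    using that
  proof (induction J rule: finite_induct)
    case empty
    then show ?case
      using phi_homotopy_axis_bump[OF p, of n] by (auto simp: M_def)
  next
    case (insert c J)
    then obtain m H where m: "n \<le> m" and H: "phi_homotopy p n m {z \<in> sphereV n. 0 < M J z} H"
      by auto
    obtain i j e where c: "c = (i, j, e)" and ije: "i < j" "j < n" "\<bar>e\<bar> = 1"
      using insert.prems by (auto simp: I_def)
    have "continuous_on (sphereV n) (M J)"
      unfolding M_def by (intro continuous_intros continuous_on_axis_bump continuous_on_chart)
    then have "\<exists>H'. phi_homotopy p n (m + 2) {z \<in> sphereV n. 0 < M J z + chart p (i, j, e) z} H'"
      using insert.prems by (intro phi_homotopy_add_chart[OF p ije m H]) (auto simp: M_nonneg M_act)
    moreover have "M J z + chart p (i, j, e) z = M (insert c J) z" for z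
      using insert.hyps by (simp add: M_def c)
    ultimately show ?case
      using m by (intro exI[of _ "m + 2"]) simp
  qed
  then obtain m H where m: "n \<le> m" and H: "phi_homotopy p n m {z \<in> sphereV n. 0 < M I z} H"
    using finI by blast
  have "0 < M I z" if z: "z \<in> sphereV n" for z
  proof -
    have ch: "0 \<le> chart p c z" if "c \<in> I" for c
      using that by (auto simp: I_def chart_nonneg)
    from axis_or_chart_pos[OF p z] show ?thesis
    proof (elim disjE exE conjE)
      assume "0 < axis_bump n z"
      then show ?thesis
        unfolding M_def using ch by (intro add_pos_nonneg sum_nonneg)
    next
      fix i j e assume "i < j" "j < n" "\<bar>e\<bar> = 1" "0 < chart p (i, j, e) z"
      then show ?thesis
        unfolding M_def using ch finI
        by (intro add_nonneg_pos axis_bump_nonneg sum_pos2[of _ "(i, j, e)"]) (auto simp: I_def)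
    qed
  qed
  then have "{z \<in> sphereV n. 0 < M I z} = sphereV n" by auto
  with H have H: "phi_homotopy p n m (sphereV n) H" by simp
  then have Hc: "continuous_on (sphereV n \<times> {0..1}) (\<lambda>(z, s). H z s)"
    by (simp add: phi_homotopy_def)
  have "continuous_on (sphereV n) (\<lambda>z. (z, 1::real))"
    by (intro continuous_intros)
  from continuous_on_compose2[OF Hc this] have "continuous_on (sphereV n) (\<lambda>z. H z 1)"
    by fastforce
  moreover have "H z 1 \<in> sphereW" if "z \<in> sphereV n" for z
    using H that by (auto simp: phi_homotopy_def conj_path_def)
  moreover have "H (actV p n t i z) 1 = actW p m t i (H z 1)" if "cmod t = 1" "z \<in> sphereV n" for t i z
    using H that by (auto simp: phi_homotopy_def)
  ultimately show ?thesis
    using m by (intro exI[of _ m] conjI exI[of _ "\<lambda>z. H z 1"]) auto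
qed

end
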